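(* Let $\ket{\psi_1},\dots,\ket{\psi_m}\in\mathbb{C}^d\otimes\mathbb{C}^d$ be pairwise orthogonal maximally entangled states shared between Alice and Bob, each occurring with probability $1/m$. Suppose Alice performs a measurement with Kraus operators $\{K_j\}$ and obtains outcome $\alpha$, producing post-measurement states $\ket{\psi_{i,\alpha}}=(K_\alpha\otimes\mathbb{1}_B)\ket{\psi_i}/\|(K_\alpha\otimes\mathbb{1}_B)\ket{\psi_i}\|$, with reduced states $\rho^{(A)}_{i,\alpha}=\mathrm{Tr}_B\ket{\psi_{i,\alpha}}\bra{\psi_{i,\alpha}}$, $\rho^{(B)}_{i,\alpha}=\mathrm{Tr}_A\ket{\psi_{i,\alpha}}\bra{\psi_{i,\alpha}}$ and average Bob state $\rho^{(B)}_{\alpha}=\frac1m\sum_{i=1}^m\rho^{(B)}_{i,\alpha}$. If the post-measurement reduced states $\rho^{(A)}_{i,\alpha}$ on Alice's side are all equal (completely indistinguishable) and the states $\{\ket{\psi_{i,\alpha}}\}_{i=1}^m$ are perfectly distinguishable by LOCC, then the von Neumann entropy satisfies $S(\rho^{(B)}_{\alpha})\ge\log_2 m$.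
   Context: $S(\rho)=-\mathrm{Tr}(\rho\log_2\rho)$ is the von Neumann entropy. LOCC denotes local operations (on Alice's and Bob's subsystems separately) and classical communication; perfect distinguishability means an LOCC protocol identifies the state with certainty. *)

theory Defs
  imports "Jordan_Normal_Form.Schur_Decomposition" "Jordan_Normal_Form.Char_Poly"
begin

text \<open>Bipartite vectors in C^dA (x) C^dB are complex vectors of dimension dA*dB;
  the basis vector |a>|b> has index a*dB + b.\<close>

definition vnorm :: "complex vec \<Rightarrow> real" where
  "vnorm v = sqrt (\<Sum>i<dim_vec v. (cmod (v $ i))^2)"

definition braket :: "complex vec \<Rightarrow> complex vec \<Rightarrow> complex" where
  "braket v w = (\<Sum>i<dim_vec v. cnj (v $ i) * w $ i)"

definition ket_bra :: "complex vec \<Rightarrow> complex mat" where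
  "ket_bra v = mat (dim_vec v) (dim_vec v) (\<lambda>(i,j). v $ i * cnj (v $ j))"

definition ptrace_B :: "nat \<Rightarrow> nat \<Rightarrow> complex mat \<Rightarrow> complex mat" where
  "ptrace_B dA dB \<rho> = mat dA dA (\<lambda>(a,a'). \<Sum>b<dB. \<rho> $$ (a*dB+b, a'*dB+b))"

definition ptrace_A :: "nat \<Rightarrow> nat \<Rightarrow> complex mat \<Rightarrow> complex mat" where
  "ptrace_A dA dB \<rho> = mat dB dB (\<lambda>(b,b'). \<Sum>a<dA. \<rho> $$ (a*dB+b, a*dB+b'))"

text \<open>(K (x) 1_B) v for K : C^dA -> C^(dim_row K), and (1_A (x) L) v for L : C^dB -> C^(dim_row L)\<close>
definition apply_A :: "complex mat \<Rightarrow> nat \<Rightarrow> complex vec \<Rightarrow> complex vec" where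
  "apply_A K dB v = vec (dim_row K * dB)
     (\<lambda>k. \<Sum>a<dim_col K. K $$ (k div dB, a) * v $ (a*dB + k mod dB))"

definition apply_B :: "complex mat \<Rightarrow> nat \<Rightarrow> complex vec \<Rightarrow> complex vec" where
  "apply_B L dA v = vec (dA * dim_row L)
     (\<lambda>k. \<Sum>b<dim_col L. L $$ (k mod dim_row L, b) * v $ ((k div dim_row L) * dim_col L + b))"

definition sum_mats :: "nat \<Rightarrow> nat \<Rightarrow> nat \<Rightarrow> (nat \<Rightarrow> complex mat) \<Rightarrow> complex mat" where
  "sum_mats r c n f = mat r c (\<lambda>(i,j). \<Sum>k<n. f k $$ (i,j))"

definition kraus_measurement :: "nat \<Rightarrow> nat \<Rightarrow> nat \<Rightarrow> (nat \<Rightarrow> complex mat) \<Rightarrow> bool" where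
  "kraus_measurement din dout n K \<longleftrightarrow>
     (\<forall>j<n. K j \<in> carrier_mat dout din) \<and>
     sum_mats din din n (\<lambda>j. mat_adjoint (K j) * K j) = 1\<^sub>m din"

text \<open>Perfect LOCC distinguishability (finite-round protocols).
  locc_dist dA dB I v: the (unnormalised, conditional) states v i, i in I, of C^dA (x) C^dB
  can be perfectly identified by LOCC. A protocol is a finite tree: at a leaf at most one
  label is still compatible with the observed outcomes (and is guessed); at an inner node
  Alice or Bob performs a local measurement (the choice depending on all previous outcomes,
  which are communicated classically) and the protocol continues on every outcome with the
  labels whose conditional state is nonzero.\<close>
inductive locc_dist :: "nat \<Rightarrow> nat \<Rightarrow> nat set \<Rightarrow> (nat \<Rightarrow> complex vec) \<Rightarrow> bool" where
  leaf: "card I \<le> 1 \<Longrightarrow> finite I \<Longrightarrow> locc_dist dA dB I v"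
| alice: "kraus_measurement dA dA' n K \<Longrightarrow>
    (\<forall>k<n. locc_dist dA' dB {i\<in>I. apply_A (K k) dB (v i) \<noteq> 0\<^sub>v (dA' * dB)}
                         (\<lambda>i. apply_A (K k) dB (v i))) \<Longrightarrow>
    locc_dist dA dB I v"
| bob: "kraus_measurement dB dB' n L \<Longrightarrow>
    (\<forall>k<n. locc_dist dA dB' {i\<in>I. apply_B (L k) dA (v i) \<noteq> 0\<^sub>v (dA * dB')}
                         (\<lambda>i. apply_B (L k) dA (v i))) \<Longrightarrow>
    locc_dist dA dB I v"

definition locc_perfectly_distinguishable :: "nat \<Rightarrow> nat \<Rightarrow> nat \<Rightarrow> (nat \<Rightarrow> complex vec) \<Rightarrow> bool" where
  "locc_perfectly_distinguishable dA dB m v \<longleftrightarrow> locc_dist dA dB {..<m} v"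

definition max_entangled :: "nat \<Rightarrow> complex vec \<Rightarrow> bool" where
  "max_entangled d \<psi> \<longleftrightarrow> \<psi> \<in> carrier_vec (d*d) \<and> vnorm \<psi> = 1 \<and>
     ptrace_B d d (ket_bra \<psi>) = (1 / of_nat d) \<cdot>\<^sub>m 1\<^sub>m d"

text \<open>von Neumann entropy S(rho) = - sum over eigenvalues (with algebraic multiplicity)
  of lambda log2 lambda, with 0 log 0 = 0 (for Hermitian rho the eigenvalues are real).\<close>
definition xlog2x :: "real \<Rightarrow> real" where
  "xlog2x x = (if x = 0 then 0 else x * log 2 x)"

definition vn_entropy :: "complex mat \<Rightarrow> real" where
  "vn_entropy \<rho> = - (\<Sum>e\<in>{e. eigenvalue \<rho> e}.
       real (order e (char_poly \<rho>)) * xlog2x (Re e))"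

end

theory Submission
  imports Defs "HOL-Analysis.L2_Norm"
begin

text \<open>By Jensen, the entropy of Bob's average state \<open>\<rho>\<close> is at least \<open>- log 2 (Tr \<rho>\<^sup>2)\<close>, so it
  suffices to bound the purity of \<open>\<rho>\<close> by \<open>1/m\<close>. Write the states as matrices \<open>V\<^sub>i\<close> with common
  Alice state \<open>V\<^sub>i V\<^sub>i\<^sup>*\<close>; up to transposition \<open>\<rho>\<close> is \<open>(1/m) \<Sum>\<^sub>i V\<^sub>i\<^sup>* V\<^sub>i\<close>. For every LOCC
  distinguishable family \<open>X\<^sub>i\<close> and every family \<open>N\<^sub>i\<close> whose products \<open>N\<^sub>i N\<^sub>i\<^sup>*\<close> all equal the same
  \<open>P P\<^sup>*\<close>, the Hilbert-Schmidt norms satisfy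
  \<open>\<parallel>\<Sum>\<^sub>i X\<^sub>i\<^sup>* N\<^sub>i\<parallel>\<^sup>2 \<le> (\<Sum>\<^sub>i \<parallel>X\<^sub>i\<parallel>\<^sup>2) \<parallel>P\<parallel>\<^sup>2\<close>, by induction on the protocol:
  Cauchy-Schwarz at a leaf; at an Alice node \<open>X\<^sub>i\<^sup>* N\<^sub>i = \<Sum>\<^sub>k (K\<^sub>k X\<^sub>i)\<^sup>* (K\<^sub>k N\<^sub>i)\<close> together with the
  triangle inequality and Cauchy-Schwarz; at a Bob node the left-hand side splits by completeness
  of the measurement. Taking \<open>X\<^sub>i = N\<^sub>i = V\<^sub>i\<close> and \<open>P = V\<^sub>0\<close> gives \<open>m\<^sup>2 Tr \<rho>\<^sup>2 \<le> m\<close>.\<close>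

section \<open>Entropy and purity\<close>

lemma order_prod_list_linear:
  fixes a :: "'a :: field"
  shows "order a (\<Prod>e\<leftarrow>es. [:- e, 1:]) = count_list es a"
proof (induction es)
  case Nil
  show ?case by simp
next
  case (Cons e es)
  have nz: "(\<Prod>e\<leftarrow>e # es. [:- e, 1:]) \<noteq> 0"
    by (subst prod_list_zero_iff) auto
  have "order a [:- e, 1:] = (if a = e then 1 else 0)"
    using order_power_n_n[of a 1] by (auto intro: order_0I)
  with Cons nz show ?case by (simp add: order_mult del: mult_pCons_left)
qed

text \<open>Turns a sum over distinct eigenvalues weighted by multiplicity, the form in which the
  entropy is defined, into a plain sum over the list of roots.\<close>

lemma sum_order_char_poly:
  fixes A :: "complex mat" and f :: "complex \<Rightarrow> real"
  assumes A: "A \<in> carrier_mat n n" and cp: "char_poly A = (\<Prod>e\<leftarrow>es. [:- e, 1:])"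
  shows "(\<Sum>e\<in>{e. eigenvalue A e}. real (order e (char_poly A)) * f e) = (\<Sum>e\<leftarrow>es. f e)"
proof -
  have "{e. eigenvalue A e} = set es"
    unfolding eigenvalue_root_char_poly[OF A] cp
    by (auto simp: poly_prod_list prod_list_zero_iff)
  \<comment> \<open>The index set is any finite superset of \<open>set es\<close>, so it stays fixed
    while the induction shortens the list.\<close>
  moreover have "(\<Sum>e\<in>S. real (count_list es e) * f e) = (\<Sum>e\<leftarrow>es. f e)"
    if "finite S" "set es \<subseteq> S" for S
    using that
  proof (induction es)
    case (Cons a es)
    have "(\<Sum>e\<in>S. real (count_list (a # es) e) * f e)
        = (\<Sum>e\<in>S. real (count_list es e) * f e + (if e = a then f e else 0))"
      by (intro sum.cong refl) (auto simp: algebra_simps)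
    then show ?case using Cons by (simp add: sum.distrib)
  qed simp
  ultimately show ?thesis
    unfolding cp order_prod_list_linear by simp
qed

lemma sum_diag_mult_comm:
  fixes A B :: "'a :: comm_semiring_0 mat"
  assumes "A \<in> carrier_mat n n" "B \<in> carrier_mat n n"
  shows "(\<Sum>i<n. (A * B) $$ (i,i)) = (\<Sum>i<n. (B * A) $$ (i,i))"
proof -
  have "(\<Sum>i<n. (A * B) $$ (i,i)) = (\<Sum>i<n. \<Sum>k<n. A $$ (i,k) * B $$ (k,i))"
    using assms by (auto simp: scalar_prod_def lessThan_atLeast0 intro!: sum.cong)
  also have "\<dots> = (\<Sum>k<n. \<Sum>i<n. B $$ (k,i) * A $$ (i,k))"
    by (subst sum.swap) (simp add: mult.commute)
  also have "\<dots> = (\<Sum>i<n. (B * A) $$ (i,i))"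
    using assms by (auto simp: scalar_prod_def lessThan_atLeast0 intro!: sum.cong)
  finally show ?thesis .
qed

lemma sum_diag_similar:
  fixes A B :: "complex mat"
  assumes A: "A \<in> carrier_mat n n" and wit: "similar_mat_wit A B P Q"
  shows "(\<Sum>i<n. A $$ (i,i)) = (\<Sum>i<n. B $$ (i,i))"
proof -
  note w = similar_mat_witD2[OF A wit]
  have "(\<Sum>i<n. A $$ (i,i)) = (\<Sum>i<n. (Q * (P * B)) $$ (i,i))"
    unfolding w(3) by (rule sum_diag_mult_comm) (use w in auto)
  also have "Q * (P * B) = B"
    using w by (simp flip: assoc_mult_mat)
  finally show ?thesis .
qed

text \<open>For \<open>k \<noteq> i\<close> one of \<open>B $$ (i,k)\<close> and
  \<open>B $$ (k,i)\<close> lies below the diagonal and vanishes.\<close>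

lemma upper_triangular_square_diag:
  fixes B :: "'a :: semiring_0 mat"
  assumes B: "B \<in> carrier_mat n n" and ut: "upper_triangular B" and i: "i < n"
  shows "(B * B) $$ (i,i) = B $$ (i,i) * B $$ (i,i)"
proof -
  have "(B * B) $$ (i,i) = (\<Sum>k<n. B $$ (i,k) * B $$ (k,i))"
    using B i by (auto simp: scalar_prod_def lessThan_atLeast0 intro!: sum.cong)
  also have "\<dots> = (\<Sum>k<n. if k = i then B $$ (i,i) * B $$ (i,i) else 0)"
  proof (rule sum.cong)
    fix k assume "k \<in> {..<n}"
    then show "B $$ (i,k) * B $$ (k,i) = (if k = i then B $$ (i,i) * B $$ (i,i) else 0)"
      using ut B i by (cases k i rule: linorder_cases) (auto simp: upper_triangular_def)
  qed simp
  finally show ?thesis using i by simp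
qed

text \<open>Schur triangularisation puts the roots on the diagonal, and similarity preserves traces,
  so the first two power sums of the roots are the traces of \<open>A\<close> and
  \<open>A * A\<close>.\<close>

lemma exists_spectrum:
  fixes A :: "complex mat"
  assumes A: "A \<in> carrier_mat n n"
  obtains es where "char_poly A = (\<Prod>e\<leftarrow>es. [:- e, 1:])"
    "(\<Sum>e\<leftarrow>es. e) = (\<Sum>i<n. A $$ (i,i))" "(\<Sum>e\<leftarrow>es. e * e) = (\<Sum>i<n. (A * A) $$ (i,i))"
proof -
  obtain es where cp: "char_poly A = (\<Prod>e\<leftarrow>es. [:- e, 1:])"
    using char_poly_factorized[OF A] by blast
  obtain B P Q where dec: "schur_decomposition A es = (B, P, Q)"
    by (cases "schur_decomposition A es")
  note s = schur_decomposition[OF A cp dec]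
  have wit: "similar_mat_wit A B P Q" and ut: "upper_triangular B" and es: "es = diag_mat B"
    using s by auto
  note w = similar_mat_witD2[OF A wit]
  \<comment> \<open>The same pair \<open>P\<close>, \<open>Q\<close> conjugates the squares, and the
    diagonal of \<open>B * B\<close> consists of the squared roots.\<close>
  have wit2: "similar_mat_wit (A ^\<^sub>m 2) (B ^\<^sub>m 2) P Q"
    by (rule similar_mat_wit_pow[OF wit])
  have sq: "X ^\<^sub>m 2 = X * X" if "X \<in> carrier_mat n n" for X :: "complex mat"
    using that by (simp add: numeral_2_eq_2)
  have "(\<Sum>i<n. (A * A) $$ (i,i)) = (\<Sum>i<n. (B * B) $$ (i,i))"
    by (rule sum_diag_similar[where P = P and Q = Q]) (use wit2 w A in \<open>auto simp: sq\<close>)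
  also have "\<dots> = (\<Sum>e\<leftarrow>es. e * e)"
    using w upper_triangular_square_diag[OF _ ut]
    by (auto simp: es diag_mat_def comp_def interv_sum_list_conv_sum_set_nat lessThan_atLeast0
      intro!: sum.cong)
  finally have 2: "(\<Sum>e\<leftarrow>es. e * e) = (\<Sum>i<n. (A * A) $$ (i,i))" by simp
  have "(\<Sum>i<n. A $$ (i,i)) = (\<Sum>i<n. B $$ (i,i))"
    by (rule sum_diag_similar[OF A wit])
  also have "\<dots> = (\<Sum>e\<leftarrow>es. e)"
    using w by (auto simp: es diag_mat_def comp_def interv_sum_list_conv_sum_set_nat lessThan_atLeast0)
  finally have 1: "(\<Sum>e\<leftarrow>es. e) = (\<Sum>i<n. A $$ (i,i))" by simp
  show ?thesis using that cp 1 2 by blast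
qed

section \<open>Entropy from purity, and positivity of Gram matrices\<close>

text \<open>The tangent line of the logarithm at \<open>q\<close> gives
  \<open>ln (x / q) \<le> x / q - 1\<close>. After multiplying by \<open>x\<close> and summing, the
  main term is \<open>log 2 q\<close> and the error is
  \<open>(\<Sum>x\<leftarrow>xs. x * x) / q - 1\<close> over \<open>ln 2\<close>, which is at most
  0.\<close>

lemma sum_list_xlog2x_le:
  fixes xs :: "real list"
  assumes nonneg: "\<And>x. x \<in> set xs \<Longrightarrow> 0 \<le> x" and sum1: "sum_list xs = 1"
    and le: "(\<Sum>x\<leftarrow>xs. x * x) \<le> q" and q: "q > 0"
  shows "(\<Sum>x\<leftarrow>xs. xlog2x x) \<le> log 2 q"
proof -
  have pt: "xlog2x x \<le> x * log 2 q + (x * x / q - x) / ln 2" if "x \<in> set xs" for x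
  proof (cases "x = 0")
    case True
    then show ?thesis by (simp add: xlog2x_def)
  next
    case False
    with nonneg[OF that] have x: "x > 0" by simp
    then have "ln (x / q) \<le> x / q - 1" using q by (intro ln_le_minus_one) simp
    then have "x * (ln x - ln q) \<le> x * (x / q - 1)"
      using x q by (simp add: ln_div)
    then have "x * (ln x - ln q) / ln 2 \<le> x * (x / q - 1) / ln 2"
      by (intro divide_right_mono) auto
    also have "x * (ln x - ln q) / ln 2 = xlog2x x - x * log 2 q"
      using False by (simp add: xlog2x_def log_def right_diff_distrib diff_divide_distrib)
    also have "x * (x / q - 1) / ln 2 = (x * x / q - x) / ln 2"
      by (simp add: right_diff_distrib)
    finally show ?thesis by simp
  qed
  have "(\<Sum>x\<leftarrow>xs. xlog2x x) \<le> (\<Sum>x\<leftarrow>xs. x * log 2 q + (x * x / q - x) / ln 2)"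
    by (intro sum_list_mono pt)
  also have "\<dots> = sum_list xs * log 2 q + ((\<Sum>x\<leftarrow>xs. x * x) / q - sum_list xs) / ln 2"
    by (induction xs) (auto simp: algebra_simps add_divide_distrib diff_divide_distrib)
  also have "\<dots> \<le> log 2 q"
    using le q sum1 by (simp add: divide_le_0_iff)
  finally show ?thesis .
qed

text \<open>The real parts of the roots form a probability vector; since the roots are real, its sum
  of squares is the trace of \<open>A * A\<close>, and the scalar bound above applies.\<close>

lemma vn_entropy_ge_of_purity:
  fixes A :: "complex mat"
  assumes A: "A \<in> carrier_mat n n"
    and pos: "\<And>e. eigenvalue A e \<Longrightarrow> Im e = 0 \<and> 0 \<le> Re e"
    and tr: "(\<Sum>i<n. A $$ (i,i)) = 1"
    and purity: "Re (\<Sum>i<n. (A * A) $$ (i,i)) \<le> q" and q: "q > 0"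
  shows "vn_entropy A \<ge> - log 2 q"
proof -
  obtain es where es: "char_poly A = (\<Prod>e\<leftarrow>es. [:- e, 1:])"
    "(\<Sum>e\<leftarrow>es. e) = (\<Sum>i<n. A $$ (i,i))" "(\<Sum>e\<leftarrow>es. e * e) = (\<Sum>i<n. (A * A) $$ (i,i))"
    using exists_spectrum[OF A] .
  have ev: "Im e = 0 \<and> 0 \<le> Re e" if "e \<in> set es" for e
    using that by (intro pos) (auto simp: eigenvalue_root_char_poly[OF A] es(1)
      poly_prod_list prod_list_zero_iff)
  have "sum_list (map Re es) = Re (\<Sum>e\<leftarrow>es. e)"
    by (induction es) auto
  then have 1: "sum_list (map Re es) = 1" using es(2) tr by simp
  have "(\<Sum>e\<leftarrow>es. Re e * Re e) = Re (\<Sum>e\<leftarrow>es. e * e)"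
    using ev by (induction es) auto
  then have 2: "(\<Sum>x\<leftarrow>map Re es. x * x) \<le> q"
    using purity by (simp add: es(3) comp_def)
  have "(\<Sum>x\<leftarrow>map Re es. xlog2x x) \<le> log 2 q"
    by (rule sum_list_xlog2x_le[OF _ 1 2 q]) (use ev in auto)
  then show ?thesis
    unfolding vn_entropy_def sum_order_char_poly[OF A es(1)] by (simp add: comp_def)
qed

text \<open>Rayleigh quotient: for an eigenvector \<open>u\<close>, \<open>r\<close> is its squared
  norm and \<open>s\<close> the quadratic form of \<open>A\<close> at \<open>u\<close>, a
  nonnegative multiple of a sum of squared moduli. Then \<open>e * r = s\<close> with
  \<open>r > 0\<close>.\<close>

lemma eigenvalue_gram_nonneg:
  fixes w :: "'k \<Rightarrow> nat \<Rightarrow> complex"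
  assumes A: "A \<in> carrier_mat n n" and c: "c \<ge> (0::real)"
    and gram: "\<And>i j. i < n \<Longrightarrow> j < n \<Longrightarrow> A $$ (i,j) = of_real c * (\<Sum>k\<in>S. w k i * cnj (w k j))"
    and ev: "eigenvalue A e"
  shows "Im e = 0 \<and> 0 \<le> Re e"
proof -
  obtain u where u: "u \<in> carrier_vec n" "u \<noteq> 0\<^sub>v n" "A *\<^sub>v u = e \<cdot>\<^sub>v u"
    using ev A unfolding eigenvalue_def eigenvector_def by auto
  define r where "r = (\<Sum>i<n. (cmod (u $ i))\<^sup>2)"
  define s where "s = c * (\<Sum>k\<in>S. (cmod (\<Sum>j<n. cnj (w k j) * u $ j))\<^sup>2)"
  have row: "(\<Sum>j<n. A $$ (i,j) * u $ j) = e * u $ i" if "i < n" for i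
  proof -
    have "(A *\<^sub>v u) $ i = e * u $ i" using u that by simp
    then show ?thesis using A u(1) that
      by (simp add: scalar_prod_def lessThan_atLeast0)
  qed
  obtain i where i: "i < n" "u $ i \<noteq> 0" using u(1,2) by (metis eq_vecI carrier_vecD index_zero_vec)
  have rpos: "r > 0"
    unfolding r_def by (rule sum_pos2[of _ i]) (use i in auto)
  have "e * of_real r = (\<Sum>i<n. cnj (u $ i) * (e * u $ i))"
    unfolding r_def of_real_sum sum_distrib_left
    by (intro sum.cong refl) (simp add: algebra_simps
      flip: complex_norm_square)
  also have "\<dots> = (\<Sum>i<n. cnj (u $ i) * (\<Sum>j<n. of_real c * (\<Sum>k\<in>S. w k i * cnj (w k j)) * u $ j))"
    by (intro sum.cong refl) (simp flip: row add: gram)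
  also have "\<dots> = of_real c * (\<Sum>i<n. \<Sum>j<n. \<Sum>k\<in>S. (cnj (u $ i) * w k i) * (cnj (w k j) * u $ j))"
    by (simp add: sum_distrib_left sum_distrib_right algebra_simps)
  also have "\<dots> = of_real c * (\<Sum>k\<in>S. \<Sum>i<n. \<Sum>j<n. (cnj (u $ i) * w k i) * (cnj (w k j) * u $ j))"
    by (subst sum.swap[of _ S], subst sum.swap[of _ S]) simp
  also have "\<dots> = of_real s"
    unfolding s_def of_real_mult of_real_sum complex_norm_square sum_product[symmetric]
    by (simp add: mult.commute)
  finally have eq: "e * of_real r = of_real s" .
  have "s \<ge> 0" unfolding s_def using c by (simp add: sum_nonneg)
  have "e = of_real (s / r)" using eq rpos by (simp add: field_simps)
  with \<open>s \<ge> 0\<close> rpos show ?thesis by simp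
qed

section \<open>Local measurements\<close>

lemma cauchy_schwarz_complex:
  "(cmod (\<Sum>a\<in>S. cnj (x a) * y a))\<^sup>2 \<le> (\<Sum>a\<in>S. (cmod (x a))\<^sup>2) * (\<Sum>a\<in>S. (cmod (y a))\<^sup>2)"
proof -
  have "cmod (\<Sum>a\<in>S. cnj (x a) * y a) \<le> (\<Sum>a\<in>S. \<bar>cmod (x a)\<bar> * \<bar>cmod (y a)\<bar>)"
    by (rule order_trans[OF norm_sum]) (simp add: norm_mult)
  also have "\<dots> \<le> L2_set (\<lambda>a. cmod (x a)) S * L2_set (\<lambda>a. cmod (y a)) S"
    by (rule L2_set_mult_ineq)
  finally have "(cmod (\<Sum>a\<in>S. cnj (x a) * y a))\<^sup>2
      \<le> (L2_set (\<lambda>a. cmod (x a)) S * L2_set (\<lambda>a. cmod (y a)) S)\<^sup>2"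
    by (intro power_mono) auto
  then show ?thesis
    by (simp add: power_mult_distrib L2_set_def sum_nonneg)
qed

lemma L2_set_sum_le: "L2_set (\<lambda>s. \<Sum>k\<in>T. f k s) S \<le> (\<Sum>k\<in>T. L2_set (f k) S)"
proof (induction T rule: infinite_finite_induct)
  case (insert k T)
  then show ?case
    using L2_set_triangle_ineq[of "f k" "\<lambda>s. \<Sum>k\<in>T. f k s" S] by simp
qed (auto simp: L2_set_0')

text \<open>Minkowski bounds the norm of the sum by the sum of \<open>sqrt (x k * t k)\<close>, and
  Cauchy-Schwarz in \<open>k\<close> separates the two factors. This recombines the branches of a
  measurement by Alice.\<close>

lemma sum_norm_sum_square_le:
  fixes F :: "'k \<Rightarrow> 's \<Rightarrow> complex"
  assumes bound: "\<And>k. k \<in> T \<Longrightarrow> (\<Sum>s\<in>S. (cmod (F k s))\<^sup>2) \<le> x k * t k"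
    and x: "\<And>k. k \<in> T \<Longrightarrow> 0 \<le> x k" and t: "\<And>k. k \<in> T \<Longrightarrow> 0 \<le> t k"
  shows "(\<Sum>s\<in>S. (cmod (\<Sum>k\<in>T. F k s))\<^sup>2) \<le> sum x T * sum t T"
proof -
  have "L2_set (\<lambda>s. cmod (\<Sum>k\<in>T. F k s)) S \<le> L2_set (\<lambda>s. \<Sum>k\<in>T. cmod (F k s)) S"
    by (intro L2_set_mono norm_sum) auto
  also have "\<dots> \<le> (\<Sum>k\<in>T. L2_set (\<lambda>s. cmod (F k s)) S)"
    by (rule L2_set_sum_le)
  also have "\<dots> \<le> (\<Sum>k\<in>T. \<bar>sqrt (x k)\<bar> * \<bar>sqrt (t k)\<bar>)"
    using bound x t by (intro sum_mono) (simp add: L2_set_def flip: real_sqrt_mult)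
  also have "\<dots> \<le> L2_set (\<lambda>k. sqrt (x k)) T * L2_set (\<lambda>k. sqrt (t k)) T"
    by (rule L2_set_mult_ineq)
  also have "\<dots> = sqrt (sum x T * sum t T)"
    using x t by (simp add: L2_set_def real_sqrt_mult cong: sum.cong)
  finally show ?thesis by (simp add: L2_set_def)
qed

section \<open>Completeness of Kraus operators and indexing of bipartite vectors\<close>

lemma mat_adjoint_mult_index:
  assumes K: "K \<in> carrier_mat dout din" and "c < din" "c' < din"
  shows "(mat_adjoint K * K) $$ (c,c') = (\<Sum>a<dout. cnj (K $$ (a,c)) * K $$ (a,c'))"
  using assms unfolding mat_adjoint_def
  by (auto simp: scalar_prod_def lessThan_atLeast0 mat_of_rows_def intro!: sum.cong)

text \<open>By completeness, stacking all \<open>K k\<close> into one tall matrix gives an isometry,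
  which preserves inner products.\<close>

lemma kraus_inner:
  assumes "kraus_measurement din dout n K"
  shows "(\<Sum>k<n. \<Sum>a<dout. cnj (\<Sum>c<din. K k $$ (a,c) * x c) * (\<Sum>c<din. K k $$ (a,c) * y c))
    = (\<Sum>c<din. cnj (x c) * y c)"
proof -
  have K: "K k \<in> carrier_mat dout din" if "k < n" for k
    using assms that by (simp add: kraus_measurement_def)
  have complete: "(\<Sum>k<n. \<Sum>a<dout. cnj (K k $$ (a,c)) * K k $$ (a,c')) = (if c = c' then 1 else 0)"
    if "c < din" "c' < din" for c c'
  proof -
    have "sum_mats din din n (\<lambda>j. mat_adjoint (K j) * K j) $$ (c,c') = 1\<^sub>m din $$ (c,c')"
      using assms by (simp add: kraus_measurement_def)
    then show ?thesis using that K by (simp add: sum_mats_def mat_adjoint_mult_index[OF K])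
  qed
  have "(\<Sum>k<n. \<Sum>a<dout. cnj (\<Sum>c<din. K k $$ (a,c) * x c) * (\<Sum>c<din. K k $$ (a,c) * y c))
    = (\<Sum>k<n. \<Sum>a<dout. \<Sum>c<din. \<Sum>c'<din.
        cnj (x c) * y c' * (cnj (K k $$ (a,c)) * K k $$ (a,c')))"
    unfolding cnj_sum sum_product by (simp add: mult_ac)
  \<comment> \<open>With \<open>c\<close> and \<open>c'\<close> outermost, the inner double sum is
    an entry of the completeness relation.\<close>
  also have "\<dots> = (\<Sum>c<din. \<Sum>c'<din. \<Sum>k<n. \<Sum>a<dout.
        cnj (x c) * y c' * (cnj (K k $$ (a,c)) * K k $$ (a,c')))"
    by (simp only: sum.swap[where A = "{..<dout}" and B = "{..<din}"] 
      sum.swap[where A = "{..<n}" and B = "{..<din}"])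
  also have "\<dots> = (\<Sum>c<din. \<Sum>c'<din. cnj (x c) * y c' * (if c = c' then 1 else 0))"
    by (intro sum.cong refl) (simp add: complete flip: sum_distrib_left)
  also have "\<dots> = (\<Sum>c<din. cnj (x c) * y c)"
    by (simp add: if_distrib cong: if_cong)
  finally show ?thesis .
qed

lemma kraus_norm:
  assumes "kraus_measurement din dout n K"
  shows "(\<Sum>k<n. \<Sum>a<dout. (cmod (\<Sum>c<din. K k $$ (a,c) * x c))\<^sup>2) = (\<Sum>c<din. (cmod (x c))\<^sup>2)"
proof -
  have "complex_of_real (\<Sum>k<n. \<Sum>a<dout. (cmod (\<Sum>c<din. K k $$ (a,c) * x c))\<^sup>2)
      = complex_of_real (\<Sum>c<din. (cmod (x c))\<^sup>2)"
    unfolding of_real_sum complex_norm_square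
    using kraus_inner[OF assms, of x x] by (simp add: mult.commute)
  then show ?thesis by (simp only: of_real_eq_iff)
qed

lemma pair_index_less:
  fixes a b dA dB :: nat
  assumes "a < dA" "b < dB"
  shows "a * dB + b < dA * dB"
proof -
  have "a * dB + b < Suc a * dB" using assms by simp
  also have "\<dots> \<le> dA * dB" using assms by (intro mult_right_mono) auto
  finally show ?thesis .
qed

lemma apply_A_index:
  assumes "a < dim_row K" "b < dB"
  shows "apply_A K dB v $ (a * dB + b) = (\<Sum>c<dim_col K. K $$ (a,c) * v $ (c * dB + b))"
  using assms pair_index_less[OF assms] by (simp add: apply_A_def)

lemma apply_B_index:
  assumes "a < dA" "b < dim_row L"
  shows "apply_B L dA v $ (a * dim_row L + b) = (\<Sum>c<dim_col L. L $$ (b,c) * v $ (a * dim_col L + c))"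
  using assms pair_index_less[OF assms] by (simp add: apply_B_def)


text \<open>\<open>N\<close> is kept independent of \<open>v\<close> because a measurement by Bob destroys the equality of Alice's
  reduced states: there \<open>v\<close> is updated and \<open>N\<close>, \<open>P\<close> stay, whereas Alice's operators act on all three.\<close>

lemma locc_dist_overlap_bound:
  assumes "locc_dist dA dB I v" and "finite I"
    and "\<And>i a a'. i \<in> I \<Longrightarrow> a < dA \<Longrightarrow> a' < dA \<Longrightarrow>
      (\<Sum>c<dC. N i a c * cnj (N i a' c)) = (\<Sum>c<dC. P a c * cnj (P a' c))"
  shows "(\<Sum>(b,c)\<in>{..<dB}\<times>{..<dC}. (cmod (\<Sum>i\<in>I. \<Sum>a<dA. cnj (v i $ (a * dB + b)) * N i a c))\<^sup>2)
    \<le> (\<Sum>i\<in>I. \<Sum>a<dA. \<Sum>b<dB. (cmod (v i $ (a * dB + b)))\<^sup>2) * (\<Sum>a<dA. \<Sum>c<dC. (cmod (P a c))\<^sup>2)"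
  using assms
proof (induction arbitrary: N P rule: locc_dist.induct)
  case (leaf I dA dB v)
  show ?case
  proof (cases "I = {}")
    case True
    then show ?thesis by simp
  next
    case False
    then obtain i where I: "I = {i}" using leaf.hyps
      by (metis card_0_eq card_1_singletonE le_Suc_eq One_nat_def le_zero_eq)
    \<comment> \<open>The diagonal case \<open>a = a'\<close> of the Gram hypothesis: corresponding
      rows of \<open>N i\<close> and \<open>P\<close> have equal norms.\<close>
    have P: "(\<Sum>c<dC. (cmod (N i a c))\<^sup>2) = (\<Sum>c<dC. (cmod (P a c))\<^sup>2)" if "a < dA" for a
    proof -
      have "complex_of_real (\<Sum>c<dC. (cmod (N i a c))\<^sup>2) = complex_of_real (\<Sum>c<dC. (cmod (P a c))\<^sup>2)"
        unfolding of_real_sum complex_norm_square using leaf.prems I that by simp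
      then show ?thesis by (simp only: of_real_eq_iff)
    qed
    \<comment> \<open>Cauchy-Schwarz in \<open>a\<close> for each pair \<open>(b,c)\<close>. The
      bound is a function of \<open>b\<close> times a function of \<open>c\<close>, so the double
      sum factorises.\<close>
    have "(\<Sum>(b,c)\<in>{..<dB}\<times>{..<dC}. (cmod (\<Sum>a<dA. cnj (v i $ (a * dB + b)) * N i a c))\<^sup>2)
      \<le> (\<Sum>(b,c)\<in>{..<dB}\<times>{..<dC}. (\<Sum>a<dA. (cmod (v i $ (a * dB + b)))\<^sup>2) * (\<Sum>a<dA. (cmod (N i a c))\<^sup>2))"
      by (intro sum_mono) (auto intro!: cauchy_schwarz_complex)
    also have "\<dots> = (\<Sum>b<dB. \<Sum>a<dA. (cmod (v i $ (a * dB + b)))\<^sup>2) * (\<Sum>c<dC. \<Sum>a<dA. (cmod (N i a c))\<^sup>2)"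
      by (simp only: sum.cartesian_product[symmetric] sum_product[symmetric])
    also have "(\<Sum>b<dB. \<Sum>a<dA. (cmod (v i $ (a * dB + b)))\<^sup>2) = (\<Sum>a<dA. \<Sum>b<dB. (cmod (v i $ (a * dB + b)))\<^sup>2)"
      by (rule sum.swap)
    also have "(\<Sum>c<dC. \<Sum>a<dA. (cmod (N i a c))\<^sup>2) = (\<Sum>a<dA. \<Sum>c<dC. (cmod (P a c))\<^sup>2)"
      by (subst sum.swap) (simp add: P)
    finally show ?thesis by (simp add: I)
  qed
next
  case (alice dA dA' n K dB I v)
  have K: "K k \<in> carrier_mat dA' dA" if "k < n" for k
    using alice.hyps that by (simp add: kraus_measurement_def)
  \<comment> \<open>\<open>J k\<close> holds the labels that survive outcome \<open>k\<close>;
    \<open>N'\<close>, \<open>P'\<close> and \<open>v'\<close> are the images under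
    \<open>K k\<close>.\<close>
  define J where "J k = {i\<in>I. apply_A (K k) dB (v i) \<noteq> 0\<^sub>v (dA' * dB)}" for k
  define N' where "N' k i a c = (\<Sum>e<dA. K k $$ (a,e) * N i e c)" for k i a c
  define P' where "P' k a c = (\<Sum>e<dA. K k $$ (a,e) * P e c)" for k a c
  define v' where "v' k i = apply_A (K k) dB (v i)" for k i
  define F where "F k = (\<lambda>(b,c). \<Sum>i\<in>J k. \<Sum>a<dA'. cnj (v' k i $ (a * dB + b)) * N' k i a c)" for k
  define x where "x k = (\<Sum>i\<in>J k. \<Sum>a<dA'. \<Sum>b<dB. (cmod (v' k i $ (a * dB + b)))\<^sup>2)" for k
  define t where "t k = (\<Sum>a<dA'. \<Sum>c<dC. (cmod (P' k a c))\<^sup>2)" for k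
  have v': "v' k i $ (a * dB + b) = (\<Sum>e<dA. K k $$ (a,e) * v i $ (e * dB + b))"
    if "k < n" "a < dA'" "b < dB" for k i a b
    using that K[of k] apply_A_index[of a "K k" b dB "v i"] by (simp add: v'_def)
  \<comment> \<open>Discarded labels have zero conditional vectors, so sums over \<open>J k\<close>
    extend to all of \<open>I\<close>.\<close>
  have v'0: "v' k i $ (a * dB + b) = 0" if "i \<in> I - J k" "a < dA'" "b < dB" for k i a b
    using that pair_index_less[of a dA' b dB] by (simp add: J_def v'_def)
  \<comment> \<open>The Gram matrix of the image under \<open>K k\<close> depends only on the Gram
    matrix before, so equality with that of \<open>P\<close> is inherited.\<close>
  have gram: "(\<Sum>c<dC. N' k i a c * cnj (N' k i a' c)) = (\<Sum>c<dC. P' k a c * cnj (P' k a' c))"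
    if "i \<in> I" for k i a a'
  proof -
    have expand: "(\<Sum>c<dC. (\<Sum>e<dA. K k $$ (a,e) * M e c) * cnj (\<Sum>e<dA. K k $$ (a',e) * M e c))
      = (\<Sum>e<dA. \<Sum>e'<dA. K k $$ (a,e) * cnj (K k $$ (a',e')) * (\<Sum>c<dC. M e c * cnj (M e' c)))" for M
    proof -
      have "(\<Sum>c<dC. (\<Sum>e<dA. K k $$ (a,e) * M e c) * cnj (\<Sum>e<dA. K k $$ (a',e) * M e c))
        = (\<Sum>c<dC. \<Sum>e<dA. \<Sum>e'<dA. K k $$ (a,e) * cnj (K k $$ (a',e')) * (M e c * cnj (M e' c)))"
        unfolding cnj_sum sum_product by (simp add: mult_ac)
      also have "\<dots> = (\<Sum>e<dA. \<Sum>e'<dA. \<Sum>c<dC. K k $$ (a,e) * cnj (K k $$ (a',e')) * (M e c * cnj (M e' c)))"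
        by (subst sum.swap, rule sum.cong[OF refl], rule sum.swap)
      finally show ?thesis by (simp add: sum_distrib_left)
    qed
    show ?thesis unfolding N'_def P'_def expand
      by (intro sum.cong refl) (use alice.prems(2)[OF that] in simp)
  qed
  have step: "(\<Sum>s\<in>{..<dB}\<times>{..<dC}. (cmod (F k s))\<^sup>2) \<le> x k * t k" if "k < n" for k
  proof -
    have IH: "(\<And>i a a'. i \<in> J k \<Longrightarrow> a < dA' \<Longrightarrow> a' < dA' \<Longrightarrow>
        (\<Sum>c<dC. N' k i a c * cnj (N' k i a' c)) = (\<Sum>c<dC. P' k a c * cnj (P' k a' c))) \<Longrightarrow> finite (J k) \<Longrightarrow>
      (\<Sum>(b,c)\<in>{..<dB}\<times>{..<dC}. (cmod (\<Sum>i\<in>J k. \<Sum>a<dA'. cnj (v' k i $ (a * dB + b)) * N' k i a c))\<^sup>2) \<le> x k * t k"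
      using alice.IH that unfolding x_def t_def J_def v'_def by blast
    have "J k \<subseteq> I" by (auto simp: J_def)
    then have "finite (J k)" "\<And>i. i \<in> J k \<Longrightarrow> i \<in> I"
      using alice.prems(1) by (auto intro: finite_subset)
    from IH[OF gram[OF this(2)] this(1)] show ?thesis
      by (simp add: F_def case_prod_unfold)
  qed
  \<comment> \<open>For fixed \<open>i\<close>, \<open>b\<close>, \<open>c\<close> the inner sum is
    an inner product over Alice's index, which completeness distributes over the outcomes.\<close>
  have split: "(\<Sum>i\<in>I. \<Sum>a<dA. cnj (v i $ (a * dB + b)) * N i a c) = (\<Sum>k<n. F k (b,c))"
    if "b < dB" "c < dC" for b c
  proof -
    have "(\<Sum>i\<in>I. \<Sum>a<dA. cnj (v i $ (a * dB + b)) * N i a c)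
      = (\<Sum>i\<in>I. \<Sum>k<n. \<Sum>a<dA'. cnj (v' k i $ (a * dB + b)) * N' k i a c)"
      by (subst kraus_inner[OF alice.hyps(1), symmetric]) (use that in \<open>simp add: v' N'_def\<close>)
    also have "\<dots> = (\<Sum>k<n. \<Sum>i\<in>I. \<Sum>a<dA'. cnj (v' k i $ (a * dB + b)) * N' k i a c)"
      by (rule sum.swap)
    also have "\<dots> = (\<Sum>k<n. F k (b,c))"
      unfolding F_def prod.case
      by (intro sum.cong refl sum.mono_neutral_right) (use alice.prems(1) v'0 that in \<open>auto simp: J_def\<close>)
    finally show ?thesis .
  qed
  have xsum: "sum x {..<n} = (\<Sum>i\<in>I. \<Sum>a<dA. \<Sum>b<dB. (cmod (v i $ (a * dB + b)))\<^sup>2)"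
  proof -
    have "sum x {..<n} = (\<Sum>k<n. \<Sum>i\<in>I. \<Sum>a<dA'. \<Sum>b<dB. (cmod (v' k i $ (a * dB + b)))\<^sup>2)"
      unfolding x_def
      by (intro sum.cong refl sum.mono_neutral_left) (use alice.prems(1) v'0 in \<open>auto simp: J_def\<close>)
    also have "\<dots> = (\<Sum>i\<in>I. \<Sum>k<n. \<Sum>b<dB. \<Sum>a<dA'. (cmod (v' k i $ (a * dB + b)))\<^sup>2)"
      by (subst sum.swap, rule sum.cong[OF refl], rule sum.cong[OF refl], rule sum.swap)
    also have "\<dots> = (\<Sum>i\<in>I. \<Sum>b<dB. \<Sum>k<n. \<Sum>a<dA'. (cmod (v' k i $ (a * dB + b)))\<^sup>2)"
      by (rule sum.cong[OF refl], rule sum.swap)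
    also have "\<dots> = (\<Sum>i\<in>I. \<Sum>b<dB. \<Sum>a<dA. (cmod (v i $ (a * dB + b)))\<^sup>2)"
      by (rule sum.cong[OF refl], rule sum.cong[OF refl], subst kraus_norm[OF alice.hyps(1), symmetric]) (simp add: v')
    also have "\<dots> = (\<Sum>i\<in>I. \<Sum>a<dA. \<Sum>b<dB. (cmod (v i $ (a * dB + b)))\<^sup>2)"
      by (rule sum.cong[OF refl], rule sum.swap)
    finally show ?thesis .
  qed
  have tsum: "sum t {..<n} = (\<Sum>a<dA. \<Sum>c<dC. (cmod (P a c))\<^sup>2)"
  proof -
    have "sum t {..<n} = (\<Sum>k<n. \<Sum>c<dC. \<Sum>a<dA'. (cmod (P' k a c))\<^sup>2)"
      unfolding t_def by (rule sum.cong[OF refl], rule sum.swap)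
    also have "\<dots> = (\<Sum>c<dC. \<Sum>k<n. \<Sum>a<dA'. (cmod (P' k a c))\<^sup>2)"
      by (rule sum.swap)
    also have "\<dots> = (\<Sum>c<dC. \<Sum>a<dA. (cmod (P a c))\<^sup>2)"
      unfolding P'_def kraus_norm[OF alice.hyps(1)] ..
    also have "\<dots> = (\<Sum>a<dA. \<Sum>c<dC. (cmod (P a c))\<^sup>2)" by (rule sum.swap)
    finally show ?thesis .
  qed
  \<comment> \<open>The branch bounds \<open>x k * t k\<close> recombine, and completeness conserves
    the totals of both weights.\<close>
  have "(\<Sum>s\<in>{..<dB}\<times>{..<dC}. (cmod (\<Sum>k<n. F k s))\<^sup>2) \<le> sum x {..<n} * sum t {..<n}"
    by (rule sum_norm_sum_square_le) (use step in \<open>auto simp: x_def t_def intro!: sum_nonneg\<close>)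
  moreover have "(\<Sum>s\<in>{..<dB}\<times>{..<dC}. (cmod (\<Sum>k<n. F k s))\<^sup>2)
    = (\<Sum>(b,c)\<in>{..<dB}\<times>{..<dC}. (cmod (\<Sum>i\<in>I. \<Sum>a<dA. cnj (v i $ (a * dB + b)) * N i a c))\<^sup>2)"
    by (intro sum.cong refl) (auto simp: split)
  ultimately show ?case unfolding xsum tsum by simp
next
  case (bob dB dB' n L dA I v)
  have L: "L k \<in> carrier_mat dB' dB" if "k < n" for k
    using bob.hyps that by (simp add: kraus_measurement_def)
  define J where "J k = {i\<in>I. apply_B (L k) dA (v i) \<noteq> 0\<^sub>v (dA * dB')}" for k
  define v' where "v' k i = apply_B (L k) dA (v i)" for k i
  define F where "F b c = (\<Sum>i\<in>I. \<Sum>a<dA. cnj (v i $ (a * dB + b)) * N i a c)" for b c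
  define F' where "F' k b c = (\<Sum>i\<in>J k. \<Sum>a<dA. cnj (v' k i $ (a * dB' + b)) * N i a c)" for k b c
  define x where "x k = (\<Sum>i\<in>J k. \<Sum>a<dA. \<Sum>b<dB'. (cmod (v' k i $ (a * dB' + b)))\<^sup>2)" for k
  define t where "t = (\<Sum>a<dA. \<Sum>c<dC. (cmod (P a c))\<^sup>2)"
  have v': "v' k i $ (a * dB' + b) = (\<Sum>e<dB. L k $$ (b,e) * v i $ (a * dB + e))"
    if "k < n" "a < dA" "b < dB'" for k i a b
    using that L[of k] apply_B_index[of a dA b "L k" "v i"] by (simp add: v'_def)
  have v'0: "v' k i $ (a * dB' + b) = 0" if "i \<in> I - J k" "a < dA" "b < dB'" for k i a b
    using that pair_index_less[of a dA b dB'] by (simp add: J_def v'_def)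
  \<comment> \<open>Bob's measurement leaves Alice's index alone, so \<open>N\<close> and
    \<open>P\<close> enter the induction hypothesis unchanged and every branch has the same weight
    \<open>t\<close>.\<close>
  have step: "(\<Sum>b<dB'. \<Sum>c<dC. (cmod (F' k b c))\<^sup>2) \<le> x k * t" if "k < n" for k
  proof -
    have IH: "(\<And>i a a'. i \<in> J k \<Longrightarrow> a < dA \<Longrightarrow> a' < dA \<Longrightarrow>
        (\<Sum>c<dC. N i a c * cnj (N i a' c)) = (\<Sum>c<dC. P a c * cnj (P a' c))) \<Longrightarrow> finite (J k) \<Longrightarrow>
      (\<Sum>(b,c)\<in>{..<dB'}\<times>{..<dC}. (cmod (\<Sum>i\<in>J k. \<Sum>a<dA. cnj (v' k i $ (a * dB' + b)) * N i a c))\<^sup>2) \<le> x k * t"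
      using bob.IH that unfolding x_def t_def J_def v'_def by blast
    have "J k \<subseteq> I" by (auto simp: J_def)
    then have "finite (J k)" "\<And>i. i \<in> J k \<Longrightarrow> i \<in> I"
      using bob.prems(1) by (auto intro: finite_subset)
    from IH[OF bob.prems(2)[OF this(2)] this(1)] show ?thesis
      by (simp add: F'_def sum.cartesian_product)
  qed
  \<comment> \<open>Bob's operator acts on \<open>v\<close>, which enters conjugated; conjugating
    the whole expression exhibits \<open>L k\<close> applied to the vector
    \<open>cnj (F e c)\<close> indexed by \<open>e\<close>, to which completeness applies.\<close>
  have F': "F' k b c = cnj (\<Sum>e<dB. L k $$ (b,e) * cnj (F e c))"
    if "k < n" "b < dB'" for k b c
  proof -
    have "F' k b c = (\<Sum>i\<in>I. \<Sum>a<dA. cnj (v' k i $ (a * dB' + b)) * N i a c)"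
      unfolding F'_def
      by (intro sum.mono_neutral_left) (use bob.prems(1) v'0 that in \<open>auto simp: J_def\<close>)
    also have "\<dots> = (\<Sum>i\<in>I. \<Sum>a<dA. \<Sum>e<dB. cnj (L k $$ (b,e)) * (cnj (v i $ (a * dB + e)) * N i a c))"
      by (intro sum.cong refl) (use that in \<open>simp add: v' sum_distrib_right mult.assoc\<close>)
    also have "\<dots> = (\<Sum>i\<in>I. \<Sum>e<dB. \<Sum>a<dA. cnj (L k $$ (b,e)) * (cnj (v i $ (a * dB + e)) * N i a c))"
      by (rule sum.cong[OF refl], rule sum.swap)
    also have "\<dots> = (\<Sum>e<dB. \<Sum>i\<in>I. \<Sum>a<dA. cnj (L k $$ (b,e)) * (cnj (v i $ (a * dB + e)) * N i a c))"
      by (rule sum.swap)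
    also have "\<dots> = cnj (\<Sum>e<dB. L k $$ (b,e) * cnj (F e c))"
      by (simp add: F_def sum_distrib_left)
    finally show ?thesis .
  qed
  have F'_norm: "cmod (F' k b c) = cmod (\<Sum>e<dB. L k $$ (b,e) * cnj (F e c))"
    if "k < n" "b < dB'" for k b c
    by (simp only: F'[OF that] complex_mod_cnj)
  have xsum: "sum x {..<n} = (\<Sum>i\<in>I. \<Sum>a<dA. \<Sum>b<dB. (cmod (v i $ (a * dB + b)))\<^sup>2)"
  proof -
    have "sum x {..<n} = (\<Sum>k<n. \<Sum>i\<in>I. \<Sum>a<dA. \<Sum>b<dB'. (cmod (v' k i $ (a * dB' + b)))\<^sup>2)"
      unfolding x_def
      by (intro sum.cong refl sum.mono_neutral_left) (use bob.prems(1) v'0 in \<open>auto simp: J_def\<close>)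
    also have "\<dots> = (\<Sum>i\<in>I. \<Sum>a<dA. \<Sum>k<n. \<Sum>b<dB'. (cmod (v' k i $ (a * dB' + b)))\<^sup>2)"
      by (subst sum.swap, rule sum.cong[OF refl], rule sum.swap)
    also have "\<dots> = (\<Sum>i\<in>I. \<Sum>a<dA. \<Sum>b<dB. (cmod (v i $ (a * dB + b)))\<^sup>2)"
      by (rule sum.cong[OF refl], rule sum.cong[OF refl], subst kraus_norm[OF bob.hyps(1), symmetric]) (simp add: v')
    finally show ?thesis .
  qed
  have "(\<Sum>(b,c)\<in>{..<dB}\<times>{..<dC}. (cmod (F b c))\<^sup>2) = (\<Sum>c<dC. \<Sum>b<dB. (cmod (cnj (F b c)))\<^sup>2)"
    by (subst sum.swap) (simp add: sum.cartesian_product)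
  also have "\<dots> = (\<Sum>c<dC. \<Sum>k<n. \<Sum>b<dB'. (cmod (F' k b c))\<^sup>2)"
    by (rule sum.cong[OF refl], subst kraus_norm[OF bob.hyps(1), symmetric])
      (simp add: F'_norm)
  also have "\<dots> = (\<Sum>k<n. \<Sum>b<dB'. \<Sum>c<dC. (cmod (F' k b c))\<^sup>2)"
    by (subst sum.swap, rule sum.cong[OF refl], rule sum.swap)
  \<comment> \<open>As \<open>t\<close> does not depend on the outcome, the branch bounds simply add
    up.\<close>
  also have "\<dots> \<le> (\<Sum>k<n. x k * t)"
    by (intro sum_mono step) simp
  also have "\<dots> = sum x {..<n} * t" by (simp add: sum_distrib_right)
  finally show ?case unfolding xsum t_def F_def .
qed

section \<open>Average reduced states\<close>

text \<open>The overlap bound with \<open>v 0\<close> as reference gives purity at most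
  \<open>1 / m\<close>; the Gram form and unit trace of the average state then allow the passage to
  entropy.\<close>

lemma vn_entropy_average_ge_log_card:
  fixes v :: "nat \<Rightarrow> complex vec"
  assumes m: "m \<ge> 1" and dim: "\<And>i. i < m \<Longrightarrow> v i \<in> carrier_vec (dA * dB)"
    and unit: "\<And>i. i < m \<Longrightarrow> vnorm (v i) = 1"
    and eqA: "\<And>i j. i < m \<Longrightarrow> j < m \<Longrightarrow> ptrace_B dA dB (ket_bra (v i)) = ptrace_B dA dB (ket_bra (v j))"
    and locc: "locc_perfectly_distinguishable dA dB m v"
  shows "vn_entropy ((1 / of_nat m) \<cdot>\<^sub>m sum_mats dB dB m (\<lambda>i. ptrace_A dA dB (ket_bra (v i)))) \<ge> log 2 (real m)"
proof -
  define \<rho> where "\<rho> = (1 / of_nat m) \<cdot>\<^sub>m sum_mats dB dB m (\<lambda>i. ptrace_A dA dB (ket_bra (v i)))"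
  \<comment> \<open>\<open>w (i,a)\<close> is the unnormalised vector on Bob's side attached to
    Alice's basis index \<open>a\<close> in state \<open>i\<close>; \<open>\<rho>\<close> is
    \<open>1 / m\<close> times the sum of the corresponding rank-one operators.\<close>
  define w where "w = (\<lambda>(i,a) b. v i $ (a * dB + b))"
  have carrier: "\<rho> \<in> carrier_mat dB dB" by (simp add: \<rho>_def sum_mats_def)
  have entry: "\<rho> $$ (b,b') = of_real (1 / real m) *
      (\<Sum>i<m. \<Sum>a<dA. v i $ (a * dB + b) * cnj (v i $ (a * dB + b')))"
    if "b < dB" "b' < dB" for b b'
  proof -
    have "(\<Sum>a<dA. ket_bra (v i) $$ (a * dB + b, a * dB + b'))
        = (\<Sum>a<dA. v i $ (a * dB + b) * cnj (v i $ (a * dB + b')))"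
      if "i < m" for i
      using dim[OF that] \<open>b < dB\<close> \<open>b' < dB\<close> pair_index_less[of _ dA _ dB]
      by (intro sum.cong refl) (simp add: ket_bra_def)
    then show ?thesis
      using that by (simp add: \<rho>_def sum_mats_def ptrace_A_def)
  qed
  have pos: "Im e = 0 \<and> 0 \<le> Re e" if "eigenvalue \<rho> e" for e
  proof (rule eigenvalue_gram_nonneg[OF carrier _ _ that])
    fix b b' assume "b < dB" "b' < dB"
    then show "\<rho> $$ (b,b') = of_real (1 / real m) * (\<Sum>k\<in>{..<m}\<times>{..<dA}. w k b * cnj (w k b'))"
      by (simp add: entry sum.cartesian_product w_def case_prod_unfold)
  qed simp
  have norm1: "(\<Sum>a<dA. \<Sum>b<dB. (cmod (v i $ (a * dB + b)))\<^sup>2) = 1" if "i < m" for i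
  proof -
    \<comment> \<open>Each value \<open>a\<close> of Alice's index owns a block of \<open>dB\<close>
      consecutive coordinates.\<close>
    have group: "(\<Sum>b<dB. g (a * dB + b)) = sum g {a * dB..<a * dB + dB}" for g :: "nat \<Rightarrow> real" and a
      using sum.shift_bounds_nat_ivl[of g 0 "a * dB" dB] by (simp add: add.commute lessThan_atLeast0)
    have "(\<Sum>a<dA. \<Sum>b<dB. (cmod (v i $ (a * dB + b)))\<^sup>2) = (\<Sum>k<dA * dB. (cmod (v i $ k))\<^sup>2)"
      by (simp only: group[of "\<lambda>k. (cmod (v i $ k))\<^sup>2"] sum.nat_group)
    also have "\<dots> = (vnorm (v i))\<^sup>2"
      using dim[OF that] by (simp add: vnorm_def sum_nonneg)
    finally show ?thesis by (simp add: unit[OF that])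
  qed
  have total: "(\<Sum>i<m. \<Sum>a<dA. \<Sum>b<dB. (cmod (v i $ (a * dB + b)))\<^sup>2) = real m"
    by (simp add: norm1)
  have "(\<Sum>b<dB. \<rho> $$ (b,b)) = of_real (1 / real m) * (\<Sum>b<dB. \<Sum>i<m. \<Sum>a<dA. of_real ((cmod (v i $ (a * dB + b)))\<^sup>2))"
    unfolding complex_norm_square by (simp add: entry sum_distrib_left)
  also have "(\<Sum>b<dB. \<Sum>i<m. \<Sum>a<dA. complex_of_real ((cmod (v i $ (a * dB + b)))\<^sup>2))
      = of_real (\<Sum>i<m. \<Sum>a<dA. \<Sum>b<dB. (cmod (v i $ (a * dB + b)))\<^sup>2)"
    unfolding of_real_sum
    by (subst sum.swap, rule sum.cong[OF refl], rule sum.swap)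
  finally have tr: "(\<Sum>b<dB. \<rho> $$ (b,b)) = 1" using m by (simp add: total)

  \<comment> \<open>Equality of Alice's reduced states, read entrywise; label 0 exists because
    \<open>m \<ge> 1\<close>.\<close>
  have gram: "(\<Sum>c<dB. v i $ (a * dB + c) * cnj (v i $ (a' * dB + c)))
      = (\<Sum>c<dB. v 0 $ (a * dB + c) * cnj (v 0 $ (a' * dB + c)))"
    if "i \<in> {..<m}" "a < dA" "a' < dA" for i a a'
  proof -
    have "ptrace_B dA dB (ket_bra (v i)) $$ (a,a') = ptrace_B dA dB (ket_bra (v 0)) $$ (a,a')"
      using that m by (subst eqA[of i 0]) auto
    then show ?thesis using that m dim[of i] dim[of 0] pair_index_less[of _ dA _ dB]
      by (simp add: ptrace_B_def ket_bra_def)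
  qed
  define G where "G = (\<Sum>(b,c)\<in>{..<dB}\<times>{..<dB}.
      (cmod (\<Sum>i<m. \<Sum>a<dA. cnj (v i $ (a * dB + b)) * v i $ (a * dB + c)))\<^sup>2)"
  have "G \<le> real m"
    unfolding G_def using locc_dist_overlap_bound[where N = "\<lambda>i a c. v i $ (a * dB + c)" and P = "\<lambda>a c. v 0 $ (a * dB + c)",
        OF locc[unfolded locc_perfectly_distinguishable_def] finite_lessThan, OF gram] m
    by (simp add: total norm1)
  then have "(1 / real m)\<^sup>2 * G \<le> (1 / real m)\<^sup>2 * real m"
    by (rule mult_left_mono) simp
  moreover have "(\<Sum>b<dB. (\<rho> * \<rho>) $$ (b,b)) = of_real ((1 / real m)\<^sup>2 * G)"
  proof -
    \<comment> \<open>Entrywise \<open>g\<close> is \<open>m\<close> times the transpose of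
      \<open>\<rho>\<close>. Since it is Hermitian, the trace of \<open>\<rho> * \<rho>\<close> is a
      sum of squared moduli.\<close>
    define g where "g b c = (\<Sum>i<m. \<Sum>a<dA. cnj (v i $ (a * dB + b)) * v i $ (a * dB + c))" for b c
    have e: "\<rho> $$ (b,c) = of_real (1 / real m) * g c b" if "b < dB" "c < dB" for b c
      using that by (simp add: entry g_def mult.commute)
    have cnj_g: "g c b = cnj (g b c)" for b c
      by (simp add: g_def mult.commute)
    have "(\<Sum>b<dB. (\<rho> * \<rho>) $$ (b,b)) = (\<Sum>b<dB. \<Sum>c<dB. \<rho> $$ (b,c) * \<rho> $$ (c,b))"
      using carrier by (auto simp: scalar_prod_def lessThan_atLeast0 intro!: sum.cong)
    also have "\<dots> = (\<Sum>b<dB. \<Sum>c<dB. of_real ((1 / real m)\<^sup>2 * (cmod (g b c))\<^sup>2))"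
    proof (intro sum.cong refl)
      fix b c assume "b \<in> {..<dB}" "c \<in> {..<dB}"
      then show "\<rho> $$ (b,c) * \<rho> $$ (c,b) = of_real ((1 / real m)\<^sup>2 * (cmod (g b c))\<^sup>2)"
        unfolding of_real_mult complex_norm_square
        by (simp add: e cnj_g[of b c] power2_eq_square)
    qed
    also have "\<dots> = of_real ((1 / real m)\<^sup>2 * (\<Sum>(b,c)\<in>{..<dB}\<times>{..<dB}. (cmod (g b c))\<^sup>2))"
      by (simp add: sum_distrib_left sum.cartesian_product case_prod_unfold)
    finally show ?thesis unfolding g_def G_def .
  qed
  ultimately have "Re (\<Sum>b<dB. (\<rho> * \<rho>) $$ (b,b)) \<le> (1 / real m)\<^sup>2 * real m"
    by (simp only: Re_complex_of_real)
  also have "\<dots> = 1 / real m" by (simp add: power2_eq_square)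
  finally have purity: "Re (\<Sum>b<dB. (\<rho> * \<rho>) $$ (b,b)) \<le> 1 / real m" .
  have "vn_entropy \<rho> \<ge> - log 2 (1 / real m)"
    by (rule vn_entropy_ge_of_purity[OF carrier pos tr purity]) (use m in auto)
  then show ?thesis using m by (simp add: \<rho>_def log_divide)
qed

section \<open>Normalised post-measurement states\<close>

theorem theorem1:
  fixes d m n \<alpha> :: nat
    and \<psi> :: "nat \<Rightarrow> complex vec"
    and K :: "nat \<Rightarrow> complex mat"
  assumes d_pos: "d \<ge> 1" and m_pos: "m \<ge> 1"
    and me: "\<forall>i<m. max_entangled d (\<psi> i)"
    and orth: "\<forall>i<m. \<forall>j<m. i \<noteq> j \<longrightarrow> braket (\<psi> i) (\<psi> j) = 0"
    and meas: "kraus_measurement d d n K"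
    and alpha: "\<alpha> < n"
    and nonzero: "\<forall>i<m. apply_A (K \<alpha>) d (\<psi> i) \<noteq> 0\<^sub>v (d*d)"
    and equalA: "\<forall>i<m. \<forall>j<m.
        ptrace_B d d (ket_bra ((1 / complex_of_real (vnorm (apply_A (K \<alpha>) d (\<psi> i)))) \<cdot>\<^sub>v apply_A (K \<alpha>) d (\<psi> i)))
      = ptrace_B d d (ket_bra ((1 / complex_of_real (vnorm (apply_A (K \<alpha>) d (\<psi> j)))) \<cdot>\<^sub>v apply_A (K \<alpha>) d (\<psi> j)))"
    and locc: "locc_perfectly_distinguishable d d m
        (\<lambda>i. (1 / complex_of_real (vnorm (apply_A (K \<alpha>) d (\<psi> i)))) \<cdot>\<^sub>v apply_A (K \<alpha>) d (\<psi> i))"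
  shows "vn_entropy ((1 / of_nat m) \<cdot>\<^sub>m
           sum_mats d d m (\<lambda>i. ptrace_A d d (ket_bra ((1 / complex_of_real (vnorm (apply_A (K \<alpha>) d (\<psi> i)))) \<cdot>\<^sub>v apply_A (K \<alpha>) d (\<psi> i)))))
         \<ge> log 2 (real m)"
proof (rule vn_entropy_average_ge_log_card[OF m_pos])
  let ?u = "\<lambda>i. apply_A (K \<alpha>) d (\<psi> i)"
  have dim: "?u i \<in> carrier_vec (d * d)" for i
    using meas alpha by (auto simp: kraus_measurement_def apply_A_def)
  fix i assume i: "i < m"
  show "(1 / complex_of_real (vnorm (?u i))) \<cdot>\<^sub>v ?u i \<in> carrier_vec (d * d)"
    using dim by simp
  \<comment> \<open>A nonzero coordinate makes the norm positive, so the scaling really normalises;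
    at norm 0 the convention \<open>1 / 0 = 0\<close> would give the zero vector.\<close>
  obtain k where k: "k < d * d" "?u i $ k \<noteq> 0"
    using nonzero i dim[of i] by (metis eq_vecI carrier_vecD index_zero_vec)
  have pos: "vnorm (?u i) > 0"
    unfolding vnorm_def real_sqrt_gt_0_iff
    by (rule sum_pos2[of _ k]) (use k dim[of i] in auto)
  have "vnorm (c \<cdot>\<^sub>v u) = cmod c * vnorm u" for c u
    by (simp add: vnorm_def norm_mult power_mult_distrib real_sqrt_mult flip: sum_distrib_left)
  then show "vnorm ((1 / complex_of_real (vnorm (?u i))) \<cdot>\<^sub>v ?u i) = 1"
    using pos by (simp add: norm_divide)
qed (rule equalA[rule_format], assumption, assumption, rule locc)

end
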